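(* Let $Q$ be a poset in the class $\mathbb{P}^{\ell}_{MFP}$, $Q\neq\{0\}$. Consider the following statements. (1) $Q$ is a quasi-complemented poset. (2) For any $x\in Q$, there exists $y\in Q$ such that $x^{\perp}=y^{\perp\perp}$. (3) For every $x\in Q$, there exists $y\in x^{\perp}$ such that $x^{\perp}\cap y^{\perp}=\{0\}$. (4) For every $x\in Q$, there exists $y\in Q$ such that $\overline{\mathrm{int}(V(x))}=\overline{D(y)}$ (interior and closure in $Spec(Q)$). (5) For every $x\in Q$, there exists $y\in Q$ such that $V'(y)=V'(x^{\perp})$. (6) The zero-divisor graph $\Gamma(Q)$ is complemented. (7) The zero-divisor graph $\Gamma(Q)$ is uniquely complemented. (8) $Q$ is weakly quasi-complemented. (9) $Min(Q)$ (which coincides with $Min_s(Q)$, the set of minimal prime semi-ideals) is compact. Then the implications $(1)\Leftrightarrow(2)\Leftrightarrow(3)\Leftrightarrow(4)\Leftrightarrow(5)$, $(3)\Rightarrow(6)\Leftrightarrow(7)$, $(1)\Rightarrow(8)$ and $(9)\Rightarrow(8)$ hold. Moreover, if $Q$ satisfies the annihilator condition (a.c.), then statements (1) to (8) are equivalent. Further, if $Q$ is a lattice, then statements (1) to (9) are equivalent.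
   Context: Let $Q$ be a poset with least element $0$. For $A\subseteq Q$, $A^u$ is the set of upper bounds of $A$ and $A^\ell$ the set of lower bounds of $A$; $A^{u\ell}=(A^u)^\ell$, $A^{\ell u}=(A^\ell)^u$. A semi-ideal is a non-empty $I\subseteq Q$ such that $y\in I$, $x\le y$ imply $x\in I$. An ideal is a non-empty $I\subseteq Q$ such that $a,b\in I$ implies $\{a,b\}^{u\ell}\subseteq I$. A filter is, dually, a non-empty $F\subseteq Q$ such that $a,b\in F$ implies $\{a,b\}^{\ell u}\subseteq F$. An $\ell$-filter is a filter $F$ such that $\{x,y\}^\ell\cap F\ne\emptyset$ for all $x,y\in F$. A proper ideal (respectively, proper semi-ideal) $I$ is prime if $\{x,y\}^\ell\subseteq I$ implies $x\in I$ or $y\in I$; a proper filter $F$ is prime if $\{x,y\}^u\subseteq F$ implies $x\in F$ or $y\in F$. A maximal filter (maximal $\ell$-filter) is a proper filter ($\ell$-filter) maximal under inclusion among proper filters ($\ell$-filters). $\mathbb{P}^{\ell}_{MFP}$ is the class of posets with least element $0$ in which every maximal filter is prime and every maximal $\ell$-filter is a maximal filter (i.e. maximal among all proper filters). For $A\subseteq Q$ non-empty, $A^\perp=\{y\in Q : \{x,y\}^\ell=\{0\}\ \forall x\in A\}$, $x^\perp=\{x\}^\perp$, $x^{\perp\perp}=(x^\perp)^\perp$. $(x]=\{z\in Q: z\le x\}$, and $\vee$ of ideals is the join in the lattice $Id(Q)$ of all ideals of $Q$ ordered by inclusion. $Q$ is quasi-complemented if for any $x\in Q$ there is $y\neq x$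 in $Q$ with $\{x,y\}^\ell=\{0\}$ and $((x]\vee(y])^\perp=\{0\}$. $Q$ is weakly quasi-complemented if for any $x\in Q$ there exist finitely many $y_1,\dots,y_n\in Q$ distinct from $x$ with $x^{\perp\perp}=\bigcap_{i=1}^n y_i^\perp$. $Q$ satisfies the annihilator condition (a.c.) if for all $x,y\in Q$ there is $z\in Q$ with $x^\perp\cap y^\perp=z^\perp$. $Spec(Q)$ is the set of prime ideals of $Q$, $Min(Q)$ the set of minimal elements of $Spec(Q)$ under inclusion, and $Min_s(Q)$ the set of minimal prime semi-ideals. $V(a)=\{P\in Spec(Q): a\in P\}$, $D(a)=Spec(Q)\setminus V(a)$. $Spec(Q)$ carries the Zariski topology, whose closed sets are $V(I)=\bigcap_{a\in I}V(a)$ for ideals $I$ of $Q$; $Min(Q)$ has the subspace topology. $V'(a)=V(a)\cap Min(Q)$, and $V'(x^\perp)=\{P\in Min(Q): x^\perp\subseteq P\}$. Compact means every open cover has a finite subcover (Hausdorff is not required). $\Gamma(Q)$ is the simple graph whose vertices are the non-zero $x\in Q$ for which there is $y\in Q\setminus\{0\}$ with $\{x,y\}^\ell=\{0\}$, distinct $x,y$ being adjacent iff $\{x,y\}^\ell=\{0\}$. In a graph $G$, for distinct vertices $a,b$ write $a\bot b$ if $a,b$ are adjacent and no vertex is adjacent to both. $G$ is complemented if every vertex $a$ has a vertex $b$ with $a\bot b$; $G$ is uniquely complemented if it is complemented and whenever $a\bot b$ and $a\bot c$, then $b$ and $c$ are adjacent to exactly the same vertices. *)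

theory Defs
  imports "HOL-Analysis.Abstract_Topology"
begin

text \<open>The poset \<open>Q\<close> is a type \<open>'a\<close> of class \<open>order_bot\<close>, so \<open>Q = UNIV\<close> and the least
  element \<open>0\<close> is \<open>bot\<close>. Properties of \<open>Q\<close> as a whole take an argument of type \<open>'a itself\<close>.\<close>

definition ubs :: "'a::order set \<Rightarrow> 'a set" where
  "ubs A = {u. \<forall>a\<in>A. a \<le> u}"

definition lbs :: "'a::order set \<Rightarrow> 'a set" where
  "lbs A = {l. \<forall>a\<in>A. l \<le> a}"

definition semi_ideal :: "'a::order set \<Rightarrow> bool" where
  "semi_ideal I \<longleftrightarrow> I \<noteq> {} \<and> (\<forall>x y. y \<in> I \<longrightarrow> x \<le> y \<longrightarrow> x \<in> I)"

definition poset_ideal :: "'a::order set \<Rightarrow> bool" where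
  "poset_ideal I \<longleftrightarrow> I \<noteq> {} \<and> (\<forall>a\<in>I. \<forall>b\<in>I. lbs (ubs {a, b}) \<subseteq> I)"

definition poset_filter :: "'a::order set \<Rightarrow> bool" where
  "poset_filter F \<longleftrightarrow> F \<noteq> {} \<and> (\<forall>a\<in>F. \<forall>b\<in>F. ubs (lbs {a, b}) \<subseteq> F)"

definition l_filter :: "'a::order set \<Rightarrow> bool" where
  "l_filter F \<longleftrightarrow> poset_filter F \<and> (\<forall>x\<in>F. \<forall>y\<in>F. lbs {x, y} \<inter> F \<noteq> {})"

definition prime_ideal :: "'a::order set \<Rightarrow> bool" where
  "prime_ideal I \<longleftrightarrow> poset_ideal I \<and> I \<noteq> UNIV \<and>
     (\<forall>x y. lbs {x, y} \<subseteq> I \<longrightarrow> x \<in> I \<or> y \<in> I)"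

definition prime_semi_ideal :: "'a::order set \<Rightarrow> bool" where
  "prime_semi_ideal I \<longleftrightarrow> semi_ideal I \<and> I \<noteq> UNIV \<and>
     (\<forall>x y. lbs {x, y} \<subseteq> I \<longrightarrow> x \<in> I \<or> y \<in> I)"

definition prime_filter :: "'a::order set \<Rightarrow> bool" where
  "prime_filter F \<longleftrightarrow> poset_filter F \<and> F \<noteq> UNIV \<and>
     (\<forall>x y. ubs {x, y} \<subseteq> F \<longrightarrow> x \<in> F \<or> y \<in> F)"

definition maximal_filter :: "'a::order set \<Rightarrow> bool" where
  "maximal_filter F \<longleftrightarrow> poset_filter F \<and> F \<noteq> UNIV \<and>
     (\<forall>G. poset_filter G \<and> G \<noteq> UNIV \<and> F \<subseteq> G \<longrightarrow> G = F)"

definition maximal_l_filter :: "'a::order set \<Rightarrow> bool" where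
  "maximal_l_filter F \<longleftrightarrow> l_filter F \<and> F \<noteq> UNIV \<and>
     (\<forall>G. l_filter G \<and> G \<noteq> UNIV \<and> F \<subseteq> G \<longrightarrow> G = F)"

definition P_l_MFP :: "'a::order_bot itself \<Rightarrow> bool" where
  "P_l_MFP (_ :: 'a itself) \<longleftrightarrow>
     (\<forall>F::'a set. maximal_filter F \<longrightarrow> prime_filter F) \<and>
     (\<forall>F::'a set. maximal_l_filter F \<longrightarrow> maximal_filter F)"

definition perp :: "'a::order_bot set \<Rightarrow> 'a set" where
  "perp A = {y. \<forall>x\<in>A. lbs {x, y} = {bot}}"

text \<open>The join in the lattice of all ideals, see \<open>ideal_join_least\<close> below.\<close>

definition ideal_join :: "'a::order_bot set \<Rightarrow> 'a set \<Rightarrow> 'a set" where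
  "ideal_join I J = \<Inter>{K. poset_ideal K \<and> I \<subseteq> K \<and> J \<subseteq> K}"

definition quasi_complemented :: "'a::order_bot itself \<Rightarrow> bool" where
  "quasi_complemented (_ :: 'a itself) \<longleftrightarrow>
     (\<forall>x::'a. \<exists>y. y \<noteq> x \<and> lbs {x, y} = {bot} \<and> perp (ideal_join {..x} {..y}) = {bot})"

definition weakly_quasi_complemented :: "'a::order_bot itself \<Rightarrow> bool" where
  "weakly_quasi_complemented (_ :: 'a itself) \<longleftrightarrow>
     (\<forall>x::'a. \<exists>Y. finite Y \<and> Y \<noteq> {} \<and> x \<notin> Y \<and> perp (perp {x}) = (\<Inter>y\<in>Y. perp {y}))"

definition annihilator_condition :: "'a::order_bot itself \<Rightarrow> bool" where
  "annihilator_condition (_ :: 'a itself) \<longleftrightarrow>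
     (\<forall>x y::'a. \<exists>z. perp {x} \<inter> perp {y} = perp {z})"

definition is_lattice :: "'a::order itself \<Rightarrow> bool" where
  "is_lattice (_ :: 'a itself) \<longleftrightarrow>
     (\<forall>x y::'a. (\<exists>s\<in>ubs {x, y}. \<forall>u\<in>ubs {x, y}. s \<le> u) \<and>
                (\<exists>i\<in>lbs {x, y}. \<forall>l\<in>lbs {x, y}. l \<le> i))"

definition Spec :: "'a::order_bot set set" where
  "Spec = {P. prime_ideal P}"

definition Min_Spec :: "'a::order_bot set set" where
  "Min_Spec = {P \<in> Spec. \<forall>P'\<in>Spec. P' \<subseteq> P \<longrightarrow> P' = P}"

definition Min_s :: "'a::order_bot set set" where
  "Min_s = {P. prime_semi_ideal P \<and> (\<forall>P'. prime_semi_ideal P' \<and> P' \<subseteq> P \<longrightarrow> P' = P)}"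

definition V :: "'a::order_bot \<Rightarrow> 'a set set" where
  "V a = {P \<in> Spec. a \<in> P}"

definition D :: "'a::order_bot \<Rightarrow> 'a set set" where
  "D a = Spec - V a"

definition V_ideal :: "'a::order_bot set \<Rightarrow> 'a set set" where
  "V_ideal I = (\<Inter>a\<in>I. V a)"

definition V_min :: "'a::order_bot \<Rightarrow> 'a set set" where
  "V_min a = V a \<inter> Min_Spec"

definition V_min_set :: "'a::order_bot set \<Rightarrow> 'a set set" where
  "V_min_set A = {P \<in> Min_Spec. A \<subseteq> P}"

definition zariski :: "'a::order_bot set topology" where
  "zariski = topology (\<lambda>U. \<exists>I. poset_ideal I \<and> U = Spec - V_ideal I)"

definition zd_verts :: "'a::order_bot set" where
  "zd_verts = {x. x \<noteq> bot \<and> (\<exists>y. y \<noteq> bot \<and> lbs {x, y} = {bot})}"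

definition zd_adj :: "'a::order_bot \<Rightarrow> 'a \<Rightarrow> bool" where
  "zd_adj x y \<longleftrightarrow> x \<in> zd_verts \<and> y \<in> zd_verts \<and> x \<noteq> y \<and> lbs {x, y} = {bot}"

text \<open>The next three notions are for a simple graph with vertex set \<open>W\<close> and adjacency
  relation \<open>E\<close>.\<close>

definition graph_orth :: "'v set \<Rightarrow> ('v \<Rightarrow> 'v \<Rightarrow> bool) \<Rightarrow> 'v \<Rightarrow> 'v \<Rightarrow> bool" where
  "graph_orth W E a b \<longleftrightarrow>
     a \<in> W \<and> b \<in> W \<and> a \<noteq> b \<and> E a b \<and> \<not> (\<exists>c\<in>W. E c a \<and> E c b)"

definition complemented_graph :: "'v set \<Rightarrow> ('v \<Rightarrow> 'v \<Rightarrow> bool) \<Rightarrow> bool" where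
  "complemented_graph W E \<longleftrightarrow> (\<forall>a\<in>W. \<exists>b\<in>W. graph_orth W E a b)"

definition uniquely_complemented_graph :: "'v set \<Rightarrow> ('v \<Rightarrow> 'v \<Rightarrow> bool) \<Rightarrow> bool" where
  "uniquely_complemented_graph W E \<longleftrightarrow> complemented_graph W E \<and>
     (\<forall>a\<in>W. \<forall>b\<in>W. \<forall>c\<in>W. graph_orth W E a b \<and> graph_orth W E a c \<longrightarrow>
        (\<forall>d\<in>W. E d b \<longleftrightarrow> E d c))"

lemma zd_adj_sym: "zd_adj x y \<Longrightarrow> zd_adj y x"
  by (auto simp: zd_adj_def insert_commute)

lemma poset_ideal_downward: "poset_ideal I \<Longrightarrow> y \<in> I \<Longrightarrow> x \<le> y \<Longrightarrow> x \<in> I"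
proof -
  assume I: "poset_ideal I" "y \<in> I" and "x \<le> y"
  then have "x \<in> lbs (ubs {y, y})"
    unfolding ubs_def lbs_def using order_trans by blast
  then show "x \<in> I" using I unfolding poset_ideal_def by blast
qed

lemma poset_ideal_bot: "poset_ideal (I :: 'a::order_bot set) \<Longrightarrow> bot \<in> I"
  using poset_ideal_downward[of I _ bot] by (auto simp: poset_ideal_def)

lemma poset_ideal_Inter:
  assumes "\<And>I. I \<in> S \<Longrightarrow> poset_ideal (I :: 'a::order_bot set)"
  shows "poset_ideal (\<Inter>S)"
  unfolding poset_ideal_def
proof (intro conjI ballI subsetI InterI)
  show "\<Inter>S \<noteq> {}" using assms poset_ideal_bot by blast
next
  fix a b c I assume "a \<in> \<Inter>S" "b \<in> \<Inter>S" "c \<in> lbs (ubs {a, b})" "I \<in> S"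
  then show "c \<in> I" using assms[of I] unfolding poset_ideal_def by blast
qed

lemma ideal_join_least:
  shows "poset_ideal (ideal_join I J)" "I \<subseteq> ideal_join I J" "J \<subseteq> ideal_join I J"
    "poset_ideal K \<Longrightarrow> I \<subseteq> K \<Longrightarrow> J \<subseteq> K \<Longrightarrow> ideal_join I J \<subseteq> K"
proof -
  show "poset_ideal (ideal_join I J)"
    unfolding ideal_join_def by (rule poset_ideal_Inter) simp
qed (auto simp: ideal_join_def)

lemma V_ideal_eq: "poset_ideal I \<Longrightarrow> V_ideal I = {P \<in> Spec. I \<subseteq> P}"
  unfolding V_ideal_def V_def poset_ideal_def by auto

lemma istopology_zariski:
  "istopology (\<lambda>U. \<exists>I::'a::order_bot set. poset_ideal I \<and> U = Spec - V_ideal I)"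
  unfolding istopology_def
proof (intro conjI allI impI)
  fix S T :: "'a set set"
  assume "\<exists>I. poset_ideal I \<and> S = Spec - V_ideal I" "\<exists>I. poset_ideal I \<and> T = Spec - V_ideal I"
  then obtain I J where I: "poset_ideal I" "S = Spec - V_ideal I"
    and J: "poset_ideal J" "T = Spec - V_ideal J" by blast
  have K: "poset_ideal (I \<inter> J)"
    using poset_ideal_Inter[of "{I, J}"] I J by auto
  have "I \<subseteq> P \<or> J \<subseteq> P" if P: "prime_ideal P" "I \<inter> J \<subseteq> P" for P
  proof (rule ccontr)
    assume "\<not> ?thesis"
    then obtain a b where ab: "a \<in> I" "a \<notin> P" "b \<in> J" "b \<notin> P" by blast
    have "lbs {a, b} \<subseteq> I \<inter> J"
      using ab poset_ideal_downward[OF I(1)] poset_ideal_downward[OF J(1)]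
      by (auto simp: lbs_def)
    then show False using P ab unfolding prime_ideal_def by blast
  qed
  then have "S \<inter> T = Spec - V_ideal (I \<inter> J)"
    unfolding I(2) J(2) V_ideal_eq[OF I(1)] V_ideal_eq[OF J(1)] V_ideal_eq[OF K] Spec_def
    by blast
  then show "\<exists>I. poset_ideal I \<and> S \<inter> T = Spec - V_ideal I" using K by blast
next
  fix \<K> :: "'a set set set"
  assume "\<forall>U\<in>\<K>. \<exists>I. poset_ideal I \<and> U = Spec - V_ideal I"
  then obtain i where i: "\<And>U. U \<in> \<K> \<Longrightarrow> poset_ideal (i U)"
    "\<And>U. U \<in> \<K> \<Longrightarrow> U = Spec - V_ideal (i U)" by metis
  define J where "J = \<Inter>{K. poset_ideal K \<and> (\<Union>U\<in>\<K>. i U) \<subseteq> K}"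
  have J: "poset_ideal J" unfolding J_def by (rule poset_ideal_Inter) simp
  have sub: "(\<Union>U\<in>\<K>. i U) \<subseteq> J" unfolding J_def by blast
  have "J \<subseteq> P" if "prime_ideal P" "(\<Union>U\<in>\<K>. i U) \<subseteq> P" for P
    using that unfolding J_def prime_ideal_def by blast
  then have *: "J \<subseteq> P \<longleftrightarrow> (\<forall>U\<in>\<K>. i U \<subseteq> P)" if "P \<in> Spec" for P
    using that sub unfolding Spec_def by blast
  have mem: "P \<in> U \<longleftrightarrow> P \<in> Spec \<and> \<not> i U \<subseteq> P" if "U \<in> \<K>" for U P
    using i(2)[OF that] V_ideal_eq[OF i(1)[OF that]] by blast
  have "P \<in> \<Union>\<K> \<longleftrightarrow> P \<in> Spec - V_ideal J" for P
  proof -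
    have "P \<in> \<Union>\<K> \<longleftrightarrow> P \<in> Spec \<and> (\<exists>U\<in>\<K>. \<not> i U \<subseteq> P)"
      unfolding Union_iff by (metis mem)
    also have "\<dots> \<longleftrightarrow> P \<in> Spec \<and> \<not> J \<subseteq> P" using * by blast
    also have "\<dots> \<longleftrightarrow> P \<in> Spec - V_ideal J" unfolding V_ideal_eq[OF J] by auto
    finally show ?thesis .
  qed
  then have "\<Union>\<K> = Spec - V_ideal J" by (rule set_eqI)
  then show "\<exists>I. poset_ideal I \<and> \<Union>\<K> = Spec - V_ideal I" using J by blast
qed

lemma openin_zariski:
  "openin zariski U \<longleftrightarrow> (\<exists>I. poset_ideal I \<and> U = Spec - V_ideal I)"
  unfolding zariski_def by (simp add: topology_inverse' istopology_zariski)

lemma topspace_zariski: "topspace zariski = Spec"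
proof
  show "topspace zariski \<subseteq> Spec"
    unfolding topspace_def by (auto simp: openin_zariski)
  have "poset_ideal (UNIV :: 'a set)" by (simp add: poset_ideal_def)
  moreover have "Spec = Spec - V_ideal (UNIV :: 'a set)"
    unfolding V_ideal_eq[OF calculation] Spec_def prime_ideal_def by auto
  ultimately have "openin zariski (Spec :: 'a set set)"
    unfolding openin_zariski by blast
  then show "(Spec :: 'a set set) \<subseteq> topspace zariski" by (rule openin_subset)
qed

lemma closedin_zariski: "closedin zariski C \<longleftrightarrow> (\<exists>I. poset_ideal I \<and> C = V_ideal I)"
proof -
  have *: "V_ideal I \<subseteq> Spec" if "poset_ideal I" for I :: "'a set"
    using V_ideal_eq[OF that] by blast
  then show ?thesis
    unfolding closedin_def topspace_zariski openin_zariski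
  proof (intro iffI)
    assume "C \<subseteq> Spec \<and> (\<exists>I. poset_ideal I \<and> Spec - C = Spec - V_ideal I)"
    then obtain I where "C \<subseteq> Spec" "poset_ideal I" "Spec - C = Spec - V_ideal I" by blast
    then have "C = V_ideal I" using *[of I] by blast
    then show "\<exists>I. poset_ideal I \<and> C = V_ideal I" using \<open>poset_ideal I\<close> by blast
  qed (use * in blast)
qed

end

theory Submission
  imports Defs
begin

text \<open>The prime semi-ideals are exactly the complements of the proper \<open>\<ell>\<close>-filters, and in the
  class considered the complement of a maximal \<open>\<ell>\<close>-filter is even a prime ideal. Hence the minimal
  primes are the complements of the maximal \<open>\<ell>\<close>-filters, they separate the elements of \<open>Q\<close>
  from \<open>0\<close>, and \<open>x\<close> lies in a minimal prime \<open>P\<close> iff \<open>x\<^sup>\<bottom>\<close> is not contained in \<open>P\<close>. So every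
  annihilator is an intersection of minimal primes, and (1), (2), (4), (5) all become reformulations
  of (3). For lattices, (5) makes the basic open sets of \<open>Min(Q)\<close> clopen; a cover without finite
  subcover would then yield a proper filter, and the complement of a maximal filter above it
  would be an uncovered point.\<close>

section \<open>Filters and annihilators\<close>

lemma lbs_eq_bot_iff:
  "lbs {x, y} = {bot :: 'a::order_bot} \<longleftrightarrow> (\<forall>z. z \<le> x \<longrightarrow> z \<le> y \<longrightarrow> z = bot)"
  by (auto simp: lbs_def)

lemma mem_perp_iff:
  "y \<in> perp A \<longleftrightarrow> (\<forall>x\<in>A. \<forall>z. z \<le> x \<longrightarrow> z \<le> y \<longrightarrow> z = bot)"
  by (simp add: perp_def lbs_eq_bot_iff)

lemma mem_perp_singleton_iff:
  "y \<in> perp {x} \<longleftrightarrow> (\<forall>z. z \<le> x \<longrightarrow> z \<le> y \<longrightarrow> z = bot)"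
  by (simp add: mem_perp_iff)

lemma lbs_eq_bot_iff_perp: "lbs {x, y} = {bot} \<longleftrightarrow> y \<in> perp {x}"
  by (simp add: perp_def)

lemma perp_sym: "y \<in> perp {x} \<longleftrightarrow> x \<in> perp {y}"
  by (auto simp: mem_perp_singleton_iff)

lemma bot_in_perp: "bot \<in> perp A"
  by (simp add: mem_perp_iff bot_unique)

lemma perp_bot: "perp {bot} = UNIV"
  by (simp add: set_eq_iff mem_perp_iff bot_unique)

lemma self_in_perp_iff: "x \<in> perp {x} \<longleftrightarrow> x = bot"
  by (auto simp: mem_perp_singleton_iff bot_unique)

lemma perp_downward: "y \<in> perp A \<Longrightarrow> z \<le> y \<Longrightarrow> z \<in> perp A"
  unfolding mem_perp_iff using order_trans by blast

lemma perp_eq_Inter: "perp A = (\<Inter>x\<in>A. perp {x})"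
  by (auto simp: perp_def)

lemma subset_perp_perp: "A \<subseteq> perp (perp A)"
  by (auto simp: mem_perp_iff)

lemma perp_antimono: "A \<subseteq> B \<Longrightarrow> perp B \<subseteq> perp A"
  by (auto simp: perp_def)

lemma perp_perp_perp: "perp (perp (perp A)) = perp A"
  using subset_perp_perp[of A] subset_perp_perp[of "perp A"] perp_antimono by blast

lemma perp_inter_perp_perp: "perp A \<inter> perp (perp A) = {bot}"
  using bot_in_perp self_in_perp_iff unfolding perp_eq_Inter[of "perp A"] by blast

text \<open>Both annihilators are downward closed, so a common lower bound of a member of
  \<open>perp {x}\<close> and a member of \<open>perp Y\<close> lies in their intersection.
  Singletons \<open>Y\<close> serve the equivalences and the graph, finite \<open>Y\<close> the
  compactness argument.\<close>

lemma perp_perp_eqI: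
  assumes "Y \<subseteq> perp {x}" and "perp {x} \<inter> perp Y = {bot}"
  shows "perp (perp {x}) = perp Y"
proof
  show "perp (perp {x}) \<subseteq> perp Y" using assms(1) by (rule perp_antimono)
  show "perp Y \<subseteq> perp (perp {x})"
  proof
    fix z assume z: "z \<in> perp Y"
    have "v = bot" if "w \<in> perp {x}" "v \<le> w" "v \<le> z" for v w
    proof -
      have "v \<in> perp {x} \<inter> perp Y"
        using perp_downward[OF that(1,2)] perp_downward[OF z that(3)] by (rule IntI)
      then show ?thesis by (simp add: assms(2))
    qed
    then show "z \<in> perp (perp {x})" by (auto simp: mem_perp_iff)
  qed
qed

section \<open>Filters, l-filters and prime semi-ideals\<close>

lemma poset_filter_upward:
  assumes "poset_filter F" "a \<in> F" "a \<le> b"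
  shows "b \<in> F"
proof -
  have "b \<in> ubs (lbs {a, a})"
    using assms(3) order_trans unfolding ubs_def lbs_def by blast
  then show ?thesis using assms unfolding poset_filter_def by blast
qed

lemma poset_filter_proper_iff:
  "poset_filter (F :: 'a::order_bot set) \<Longrightarrow> F \<noteq> UNIV \<longleftrightarrow> bot \<notin> F"
  using poset_filter_upward[of F bot] by auto

text \<open>A member \<open>c\<close> below \<open>a\<close> and \<open>b\<close> belongs to
  \<open>lbs {a, b}\<close>, so every element of \<open>ubs (lbs {a, b})\<close> lies above
  \<open>c\<close>. Up-closed and down-directed sets are thus automatically filters.\<close>

lemma l_filter_iff:
  "l_filter F \<longleftrightarrow> F \<noteq> {} \<and> (\<forall>a\<in>F. \<forall>b. a \<le> b \<longrightarrow> b \<in> F) \<and>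
     (\<forall>a\<in>F. \<forall>b\<in>F. \<exists>c\<in>F. c \<le> a \<and> c \<le> b)" (is "?L \<longleftrightarrow> ?R")
proof
  assume ?L
  then have "poset_filter F" and "\<forall>x\<in>F. \<forall>y\<in>F. lbs {x, y} \<inter> F \<noteq> {}"
    by (auto simp: l_filter_def)
  moreover from this have "F \<noteq> {}" by (simp add: poset_filter_def)
  moreover have "\<exists>c\<in>F. c \<le> a \<and> c \<le> b" if "lbs {a, b} \<inter> F \<noteq> {}" for a b
    using that by (auto simp: lbs_def)
  ultimately show ?R using poset_filter_upward[of F] by simp
next
  assume R: ?R
  then have ne: "F \<noteq> {}" and up: "\<And>a b. a \<in> F \<Longrightarrow> a \<le> b \<Longrightarrow> b \<in> F"
    and dir: "\<And>a b. a \<in> F \<Longrightarrow> b \<in> F \<Longrightarrow> \<exists>c\<in>F. c \<le> a \<and> c \<le> b"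
    by simp_all
  have "ubs (lbs {a, b}) \<subseteq> F" if ab: "a \<in> F" "b \<in> F" for a b
  proof
    fix z assume z: "z \<in> ubs (lbs {a, b})"
    obtain c where "c \<in> F" "c \<le> a" "c \<le> b" using dir[OF ab] by auto
    then show "z \<in> F" using z by (intro up[of c z]) (auto simp: ubs_def lbs_def)
  qed
  moreover have "lbs {a, b} \<inter> F \<noteq> {}" if ab: "a \<in> F" "b \<in> F" for a b
  proof -
    obtain c where "c \<in> F" "c \<le> a" "c \<le> b" using dir[OF ab] by auto
    then show ?thesis by (auto simp: lbs_def)
  qed
  ultimately show ?L using ne by (simp add: l_filter_def poset_filter_def)
qed

lemma l_filter_upward: "l_filter F \<Longrightarrow> a \<in> F \<Longrightarrow> a \<le> b \<Longrightarrow> b \<in> F"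
  by (meson l_filter_iff)

lemma l_filter_directed:
  assumes "l_filter F" "a \<in> F" "b \<in> F"
  obtains c where "c \<in> F" "c \<le> a" "c \<le> b"
  using assms by (meson l_filter_iff)

lemma l_filter_proper_iff: "l_filter (F :: 'a::order_bot set) \<Longrightarrow> F \<noteq> UNIV \<longleftrightarrow> bot \<notin> F"
  by (simp add: l_filter_def poset_filter_proper_iff)

lemma l_filter_extends_to_maximal:
  assumes "l_filter (F :: 'a::order_bot set)" "F \<noteq> UNIV"
  obtains M where "maximal_l_filter M" "F \<subseteq> M"
proof -
  \<comment> \<open>Properness is phrased as avoiding \<open>bot\<close>, a condition that visibly
    survives unions of chains.\<close>
  define \<A> where "\<A> = {G. l_filter G \<and> bot \<notin> G \<and> F \<subseteq> G}"
  have "F \<in> \<A>" using assms by (simp add: \<A>_def l_filter_proper_iff)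
  have "\<exists>M\<in>\<A>. \<forall>X\<in>\<A>. M \<subseteq> X \<longrightarrow> X = M"
  proof (rule subset_Zorn_nonempty)
    show "\<A> \<noteq> {}" using \<open>F \<in> \<A>\<close> by blast
    fix \<C> assume C: "\<C> \<noteq> {}" "subset.chain \<A> \<C>"
    then have sub: "\<C> \<subseteq> \<A>" and tot: "\<And>X Y. X \<in> \<C> \<Longrightarrow> Y \<in> \<C> \<Longrightarrow> X \<subseteq> Y \<or> Y \<subseteq> X"
      by (auto simp: subset_chain_def)
    have filt: "l_filter X" if "X \<in> \<C>" for X using that sub by (auto simp: \<A>_def)
    have "\<Union>\<C> \<noteq> {}" using C filt by (force simp: l_filter_iff)
    moreover have "b \<in> \<Union>\<C>" if "a \<in> \<Union>\<C>" "a \<le> b" for a b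
      using that filt l_filter_upward by blast
    moreover have "\<exists>c\<in>\<Union>\<C>. c \<le> a \<and> c \<le> b" if ab: "a \<in> \<Union>\<C>" "b \<in> \<Union>\<C>" for a b
    proof -
      obtain X where X: "X \<in> \<C>" "a \<in> X" "b \<in> X" using ab tot by blast
      then show ?thesis using l_filter_directed[OF filt] by (metis UnionI)
    qed
    ultimately have "l_filter (\<Union>\<C>)" by (simp add: l_filter_iff)
    then show "\<Union>\<C> \<in> \<A>" using C sub unfolding \<A>_def by blast
  qed
  then obtain M where M: "M \<in> \<A>" "\<And>X. X \<in> \<A> \<Longrightarrow> M \<subseteq> X \<Longrightarrow> X = M" by blast
  have "maximal_l_filter M" "F \<subseteq> M"
    using M l_filter_proper_iff unfolding maximal_l_filter_def \<A>_def by blast+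
  then show thesis by (rule that)
qed

text \<open>Primeness of \<open>P\<close> is the contrapositive of down-directedness of
  \<open>- P\<close>.\<close>

lemma prime_semi_ideal_iff:
  "prime_semi_ideal P \<longleftrightarrow> l_filter (- P) \<and> - P \<noteq> UNIV"
proof -
  have "(\<forall>x y. lbs {x, y} \<subseteq> P \<longrightarrow> x \<in> P \<or> y \<in> P) \<longleftrightarrow>
      (\<forall>a\<in>- P. \<forall>b\<in>- P. \<exists>c\<in>- P. c \<le> a \<and> c \<le> b)"
    by (auto simp: lbs_def subset_iff)
  then show ?thesis
    unfolding prime_semi_ideal_def semi_ideal_def l_filter_iff by auto
qed

lemma Min_s_iff: "P \<in> Min_s \<longleftrightarrow> maximal_l_filter (- P)"
  unfolding Min_s_def maximal_l_filter_def prime_semi_ideal_iff mem_Collect_eq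
  by (metis Compl_subset_Compl_iff double_compl)

lemma prime_ideal_imp_prime_semi_ideal:
  "prime_ideal (P :: 'a::order_bot set) \<Longrightarrow> prime_semi_ideal P"
  unfolding prime_ideal_def prime_semi_ideal_def semi_ideal_def
  using poset_ideal_downward poset_ideal_bot by blast

lemma prime_ideal_perp:
  assumes "prime_ideal P" "y \<in> perp {x}" "x \<notin> P"
  shows "y \<in> P"
proof -
  have "lbs {x, y} \<subseteq> P"
    using assms poset_ideal_bot by (auto simp: perp_def prime_ideal_def)
  then show ?thesis using assms by (auto simp: prime_ideal_def)
qed

text \<open>The two hypotheses split the work: primeness of the filter makes the complement an
  ideal, and directedness of the l-filter makes that ideal prime.\<close>

lemma prime_filter_l_filter_compl:
  assumes "prime_filter (F :: 'a::order_bot set)" "l_filter F"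
  shows "prime_ideal (- F)"
proof -
  have F: "poset_filter F" "F \<noteq> UNIV" "\<And>x y. ubs {x, y} \<subseteq> F \<Longrightarrow> x \<in> F \<or> y \<in> F"
    using assms(1) by (auto simp: prime_filter_def)
  have "lbs (ubs {a, b}) \<subseteq> - F" if "a \<notin> F" "b \<notin> F" for a b
  proof
    fix c assume c: "c \<in> lbs (ubs {a, b})"
    show "c \<in> - F"
    proof
      assume "c \<in> F"
      then have "ubs {a, b} \<subseteq> F"
        using c poset_filter_upward[OF F(1)] by (auto simp: lbs_def)
      then show False using F(3) that by blast
    qed
  qed
  then have "poset_ideal (- F)" using F(2) unfolding poset_ideal_def by blast
  moreover have "- F \<noteq> UNIV" using assms(2) by (auto simp: l_filter_iff)
  moreover have "x \<in> - F \<or> y \<in> - F" if "lbs {x, y} \<subseteq> - F" for x y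
  proof (rule ccontr)
    assume "\<not> ?thesis"
    then obtain c where "c \<in> F" "c \<le> x" "c \<le> y"
      using l_filter_directed[OF assms(2), of x y] by blast
    then show False using that by (auto simp: lbs_def)
  qed
  ultimately show ?thesis unfolding prime_ideal_def by blast
qed

text \<open>Otherwise \<open>F\<close> and \<open>x\<close> would together generate a larger proper
  filter. It is shown to be a filter only, so maximality among all filters is what gets
  contradicted.\<close>

lemma maximal_l_filter_perp:
  assumes "maximal_l_filter (F :: 'a::order_bot set)" "maximal_filter F" "x \<notin> F"
  obtains y where "y \<in> F" "y \<in> perp {x}"
proof (rule ccontr)
  assume "\<not> thesis"
  then have *: "\<And>y. y \<in> F \<Longrightarrow> \<exists>z. z \<le> x \<and> z \<le> y \<and> z \<noteq> bot"
    using that by (auto simp: mem_perp_singleton_iff)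
  have F: "l_filter F" using assms(1) by (simp add: maximal_l_filter_def)
  define G where "G = (\<Union>y\<in>F. ubs (lbs {x, y}))"
  have FG: "F \<subseteq> G" by (auto simp: G_def ubs_def lbs_def)
  have "F \<noteq> {}" using F by (simp add: l_filter_iff)
  then have "x \<in> G" by (auto simp: G_def ubs_def lbs_def)
  have "bot \<notin> G"
  proof
    assume "bot \<in> G"
    then obtain y where "y \<in> F" "\<And>z. z \<le> x \<Longrightarrow> z \<le> y \<Longrightarrow> z \<le> bot"
      by (auto simp: G_def ubs_def lbs_def)
    then show False using * bot_unique by blast
  qed
  have "ubs (lbs {a, b}) \<subseteq> G" if ab: "a \<in> G" "b \<in> G" for a b
  proof
    fix u assume u: "u \<in> ubs (lbs {a, b})"
    obtain y y' where y: "y \<in> F" "a \<in> ubs (lbs {x, y})" "y' \<in> F" "b \<in> ubs (lbs {x, y'})"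
      using ab by (auto simp: G_def)
    \<comment> \<open>Directedness of \<open>F\<close> lets one \<open>c\<close> replace both
      \<open>y\<close> and \<open>y'\<close>; every element below \<open>x\<close> and
      \<open>c\<close> is then below \<open>a\<close> and \<open>b\<close>, hence below
      \<open>u\<close>.\<close>
    obtain c where c: "c \<in> F" "c \<le> y" "c \<le> y'" using l_filter_directed[OF F y(1,3)] .
    have "z \<le> u" if "z \<le> x" "z \<le> c" for z
    proof -
      have "z \<le> a" "z \<le> b"
        using that y c order_trans[OF that(2)] by (auto simp: ubs_def lbs_def)
      then show ?thesis using u by (auto simp: ubs_def lbs_def)
    qed
    then show "u \<in> G" using c(1) by (auto simp: G_def ubs_def lbs_def)
  qed
  then have "poset_filter G" using \<open>x \<in> G\<close> by (auto simp: poset_filter_def)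
  then have "G = F"
    using assms(2) FG \<open>bot \<notin> G\<close> unfolding maximal_filter_def by blast
  then show False using \<open>x \<in> G\<close> assms(3) by blast
qed

section \<open>Minimal primes\<close>

context
  assumes mfp: "P_l_MFP TYPE('a::order_bot)"
begin

text \<open>Both halves of \<open>P_l_MFP\<close> enter: the maximal l-filter \<open>- P\<close> is
  a maximal filter, and this is prime.\<close>

lemma Min_s_subset_Spec: "P \<in> (Min_s :: 'a set set) \<Longrightarrow> prime_ideal P"
proof -
  assume "P \<in> Min_s"
  then have "maximal_l_filter (- P)" by (simp add: Min_s_iff)
  then have "prime_filter (- P)" "l_filter (- P)"
    using mfp by (auto simp: P_l_MFP_def maximal_l_filter_def)
  then show "prime_ideal P" using prime_filter_l_filter_compl[of "- P"] by simp
qed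

text \<open>Below any prime ideal lies the complement of a maximal l-filter, which is again a prime
  ideal; minimality makes the two equal.\<close>

lemma Min_Spec_eq_Min_s: "(Min_Spec :: 'a set set) = Min_s"
proof
  show "Min_s \<subseteq> (Min_Spec :: 'a set set)"
    using Min_s_subset_Spec prime_ideal_imp_prime_semi_ideal
    by (auto simp: Min_Spec_def Spec_def Min_s_def)
  show "(Min_Spec :: 'a set set) \<subseteq> Min_s"
  proof
    fix P :: "'a set" assume P: "P \<in> Min_Spec"
    then have "l_filter (- P)" "- P \<noteq> UNIV"
      using prime_ideal_imp_prime_semi_ideal[of P]
      by (auto simp: Min_Spec_def Spec_def prime_semi_ideal_iff)
    then obtain M where M: "maximal_l_filter M" "- P \<subseteq> M"
      by (rule l_filter_extends_to_maximal)
    then have M': "- M \<in> Min_s" "- M \<subseteq> P" by (auto simp: Min_s_iff)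
    then have "- M = P"
      using P Min_s_subset_Spec by (auto simp: Min_Spec_def Spec_def)
    then show "P \<in> Min_s" using M' by simp
  qed
qed

lemma Min_Spec_prime: "P \<in> (Min_Spec :: 'a set set) \<Longrightarrow> prime_ideal P"
  by (simp add: Min_Spec_def Spec_def)

lemma l_filter_avoided_by_min_prime:
  assumes "l_filter (F :: 'a set)" "F \<noteq> UNIV"
  obtains P where "P \<in> Min_Spec" "P \<inter> F = {}"
proof -
  obtain M where "maximal_l_filter M" "F \<subseteq> M"
    using l_filter_extends_to_maximal[OF assms] .
  then show thesis
    using that[of "- M"] by (auto simp: Min_Spec_eq_Min_s Min_s_iff)
qed

lemma min_prime_separates:
  assumes "(x :: 'a) \<noteq> bot"
  obtains P where "P \<in> Min_Spec" "x \<notin> P"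
proof -
  have "l_filter {x..}" by (auto simp: l_filter_iff)
  moreover have "{x..} \<noteq> UNIV" using assms bot_unique by auto
  ultimately obtain P where "P \<in> Min_Spec" "P \<inter> {x..} = {}"
    by (rule l_filter_avoided_by_min_prime)
  then show thesis using that by auto
qed

text \<open>One direction holds for every prime ideal. The other is
  \<open>maximal_l_filter_perp\<close> applied to \<open>- P\<close>, and is where minimality
  counts.\<close>

lemma min_prime_mem_iff:
  assumes "P \<in> (Min_Spec :: 'a set set)"
  shows "x \<in> P \<longleftrightarrow> \<not> perp {x} \<subseteq> P"
proof
  assume "x \<in> P"
  moreover have "maximal_l_filter (- P)" "maximal_filter (- P)"
    using assms mfp by (auto simp: Min_Spec_eq_Min_s Min_s_iff P_l_MFP_def)
  ultimately obtain y where "y \<in> - P" "y \<in> perp {x}"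
    using maximal_l_filter_perp[of "- P" x] by auto
  then show "\<not> perp {x} \<subseteq> P" by blast
qed (use prime_ideal_perp[OF Min_Spec_prime[OF assms]] in blast)

lemma perp_eq_Inter_min_primes:
  "perp {x :: 'a} = \<Inter>{P \<in> Min_Spec. x \<notin> P}"
proof
  show "perp {x} \<subseteq> \<Inter>{P \<in> Min_Spec. x \<notin> P}"
    using min_prime_mem_iff by blast
  show "\<Inter>{P \<in> Min_Spec. x \<notin> P} \<subseteq> perp {x}"
  proof
    fix y assume y: "y \<in> \<Inter>{P \<in> Min_Spec. x \<notin> P}"
    show "y \<in> perp {x}"
      unfolding mem_perp_singleton_iff
    proof (intro allI impI, rule ccontr)
      \<comment> \<open>A minimal prime avoiding the nonzero common lower bound \<open>z\<close>
        contains neither \<open>x\<close> nor \<open>y\<close>, against the choice of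
        \<open>y\<close>.\<close>
      fix z assume z: "z \<le> x" "z \<le> y" "z \<noteq> bot"
      obtain P where P: "P \<in> Min_Spec" "z \<notin> P" using min_prime_separates[OF z(3)] .
      have "poset_ideal P" using Min_Spec_prime[OF P(1)] by (simp add: prime_ideal_def)
      then show False using y z P poset_ideal_downward by blast
    qed
  qed
qed

text \<open>In an arbitrary poset an annihilator need not be an ideal; here it is an intersection of
  minimal primes.\<close>

lemma poset_ideal_perp: "poset_ideal (perp (A :: 'a set))"
proof -
  have "poset_ideal (perp {x :: 'a})" for x
    unfolding perp_eq_Inter_min_primes
    using Min_Spec_prime by (intro poset_ideal_Inter) (auto simp: prime_ideal_def)
  then show ?thesis
    unfolding perp_eq_Inter[of A] by (intro poset_ideal_Inter) auto
qed

text \<open>An element \<open>z\<close> annihilates \<open>x\<close> and \<open>y\<close> iff both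
  lie in \<open>perp {z}\<close>; as this is an ideal, it then contains the whole join. This reduces
  (1) to (3).\<close>

lemma perp_ideal_join: "perp (ideal_join {..x} {..y :: 'a}) = perp {x} \<inter> perp {y}"
proof
  have "{x, y} \<subseteq> ideal_join {..x} {..y}"
    using ideal_join_least(2,3)[where I = "{..x}" and J = "{..y}"] by auto
  then show "perp (ideal_join {..x} {..y}) \<subseteq> perp {x} \<inter> perp {y}"
    by (auto simp: perp_def)
  show "perp {x} \<inter> perp {y} \<subseteq> perp (ideal_join {..x} {..y})"
  proof
    fix z assume z: "z \<in> perp {x} \<inter> perp {y}"
    then have "{..x} \<subseteq> perp {z}" "{..y} \<subseteq> perp {z}"
      using perp_sym perp_downward by blast+
    then have "ideal_join {..x} {..y} \<subseteq> perp {z}"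
      using ideal_join_least(4) poset_ideal_perp by blast
    then show "z \<in> perp (ideal_join {..x} {..y})"
      using perp_sym perp_eq_Inter by blast
  qed
qed

lemma V_min_set_perp: "V_min_set (perp {x :: 'a}) = Min_Spec - V_min x"
  using min_prime_mem_iff by (auto simp: V_min_set_def V_min_def V_def Min_Spec_def)

text \<open>By \<open>V_min_set_perp\<close>, the left side says that each minimal prime contains
  exactly one of \<open>x\<close> and \<open>y\<close>. Disjointness from both sides is then tested
  with separating minimal primes.\<close>

lemma V_min_eq_V_min_set_perp_iff:
  "V_min y = V_min_set (perp {x :: 'a}) \<longleftrightarrow> y \<in> perp {x} \<and> perp {x} \<inter> perp {y} = {bot}"
  (is "?L \<longleftrightarrow> ?R")
proof
  assume L: ?L
  then have *: "y \<in> P \<longleftrightarrow> x \<notin> P" if "P \<in> Min_Spec" for P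
    using that unfolding V_min_set_perp by (auto simp: V_min_def V_def Min_Spec_def)
  then have "y \<in> perp {x}" unfolding perp_eq_Inter_min_primes by blast
  moreover have "z = bot" if z: "z \<in> perp {x}" "z \<in> perp {y}" for z
  proof (rule ccontr)
    assume "z \<noteq> bot"
    then obtain P where "P \<in> Min_Spec" "z \<notin> P" by (rule min_prime_separates)
    then show False using z * unfolding perp_eq_Inter_min_primes by blast
  qed
  ultimately show ?R using bot_in_perp by blast
next
  assume R: ?R
  have "y \<in> P \<longleftrightarrow> x \<notin> P" if P: "P \<in> Min_Spec" for P
  proof
    show "x \<notin> P \<Longrightarrow> y \<in> P" using R P min_prime_mem_iff by blast
    show "x \<notin> P" if "y \<in> P"
    proof
      assume "x \<in> P"
      \<comment> \<open>If \<open>P\<close> contained both \<open>x\<close> and \<open>y\<close>, it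
        would miss an annihilator of each, and so a common lower bound of these two. That bound
        annihilates both \<open>x\<close> and \<open>y\<close>, so it is \<open>bot\<close>, which
        is in \<open>P\<close>.\<close>
      then obtain a b where ab: "a \<notin> P" "a \<in> perp {x}" "b \<notin> P" "b \<in> perp {y}"
        using min_prime_mem_iff[OF P] \<open>y \<in> P\<close> by blast
      moreover have "l_filter (- P)"
        using Min_Spec_prime[OF P] prime_ideal_imp_prime_semi_ideal prime_semi_ideal_iff by blast
      ultimately obtain c where c: "c \<notin> P" "c \<le> a" "c \<le> b"
        using l_filter_directed[of "- P" a b] by auto
      then have "c = bot" using R ab perp_downward by blast
      then show False
        using c Min_Spec_prime[OF P] poset_ideal_bot by (auto simp: prime_ideal_def)
    qed
  qed
  then show ?L
    unfolding V_min_set_perp by (auto simp: V_min_def V_def Min_Spec_def)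
qed

section \<open>The Zariski topology\<close>

lemma openin_D: "openin zariski (D (a :: 'a))"
proof -
  have I: "poset_ideal {..a}"
    by (auto simp: poset_ideal_def lbs_def ubs_def)
  have "D a = Spec - V_ideal {..a}"
    unfolding V_ideal_eq[OF I] D_def V_def Spec_def prime_ideal_def
    using poset_ideal_downward by auto
  then show ?thesis using I openin_zariski by blast
qed

lemma openin_zariski_base:
  assumes "openin zariski U" "P \<in> U"
  obtains a :: 'a where "P \<in> D a" "D a \<subseteq> U"
  using assms by (auto simp: openin_zariski V_ideal_def V_def D_def)

text \<open>From left to right it suffices to look at minimal primes, since they already determine
  \<open>perp {x}\<close>.\<close>

lemma D_subset_V_iff: "D a \<subseteq> V (x :: 'a) \<longleftrightarrow> a \<in> perp {x}"
proof
  assume "D a \<subseteq> V x"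
  then show "a \<in> perp {x}"
    unfolding perp_eq_Inter_min_primes by (auto simp: D_def V_def Min_Spec_def)
next
  assume "a \<in> perp {x}"
  then show "D a \<subseteq> V x"
    using prime_ideal_perp by (auto simp: D_def V_def Spec_def)
qed

lemma interior_of_V: "zariski interior_of V (x :: 'a) = (\<Union>a\<in>perp {x}. D a)"
proof
  show "zariski interior_of V x \<subseteq> (\<Union>a\<in>perp {x}. D a)"
  proof
    fix P assume "P \<in> zariski interior_of V x"
    then obtain U where U: "openin zariski U" "P \<in> U" "U \<subseteq> V x"
      by (auto simp: interior_of_def)
    obtain a where a: "P \<in> D a" "D a \<subseteq> U" using openin_zariski_base[OF U(1,2)] .
    have "a \<in> perp {x}" using a(2) U(3) unfolding D_subset_V_iff[symmetric] by (rule order_trans)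
    then show "P \<in> (\<Union>a\<in>perp {x}. D a)" using a(1) by blast
  qed
  show "(\<Union>a\<in>perp {x}. D a) \<subseteq> zariski interior_of V x"
    by (intro interior_of_maximal openin_Union) (auto simp: openin_D UN_subset_iff D_subset_V_iff[symmetric])
qed

text \<open>The right side is closed because \<open>perp A\<close> is an ideal. Conversely, a basic
  neighbourhood \<open>D b\<close> of such a \<open>P\<close> has \<open>b\<close> outside
  \<open>perp A\<close>, so it meets some \<open>D a\<close> by
  \<open>D_subset_V_iff\<close>.\<close>

lemma closure_of_Union_D:
  "zariski closure_of (\<Union>a\<in>A. D a) = {P \<in> Spec. perp (A :: 'a set) \<subseteq> P}"
proof
  have I: "poset_ideal (perp A)" by (rule poset_ideal_perp)
  have "P \<in> {P \<in> Spec. perp A \<subseteq> P}" if "P \<in> D a" "a \<in> A" for P a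
  proof -
    have "prime_ideal P" "a \<notin> P" using that by (auto simp: D_def V_def Spec_def)
    then show ?thesis
      using prime_ideal_perp[of P _ a] that(2) by (auto simp: Spec_def perp_eq_Inter[of A])
  qed
  then have "(\<Union>a\<in>A. D a) \<subseteq> {P \<in> Spec. perp A \<subseteq> P}" by (rule UN_least[OF subsetI])
  moreover have "closedin zariski {P \<in> Spec. perp A \<subseteq> P}"
    unfolding closedin_zariski V_ideal_eq[OF I, symmetric] by (rule exI[of _ "perp A"]) (simp add: I)
  ultimately show "zariski closure_of (\<Union>a\<in>A. D a) \<subseteq> {P \<in> Spec. perp A \<subseteq> P}"
    by (rule closure_of_minimal)
  show "{P \<in> Spec. perp A \<subseteq> P} \<subseteq> zariski closure_of (\<Union>a\<in>A. D a)"
  proof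
    fix P assume P: "P \<in> {P \<in> Spec. perp A \<subseteq> P}"
    have "\<exists>R. R \<in> (\<Union>a\<in>A. D a) \<and> R \<in> U" if U: "openin zariski U" "P \<in> U" for U
    proof -
      obtain b where b: "P \<in> D b" "D b \<subseteq> U" using openin_zariski_base[OF U] .
      then have "b \<notin> perp A" using P by (auto simp: D_def V_def)
      then obtain a where "a \<in> A" "b \<notin> perp {a}" by (auto simp: perp_eq_Inter[of A])
      then obtain R where "R \<in> D b" "R \<notin> V a" using D_subset_V_iff by blast
      then have "R \<in> D a" by (auto simp: D_def)
      then show ?thesis using \<open>a \<in> A\<close> \<open>R \<in> D b\<close> b by blast
    qed
    then show "P \<in> zariski closure_of (\<Union>a\<in>A. D a)"
      using P by (auto simp: in_closure_of topspace_zariski)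
  qed
qed

lemma closure_of_Union_D_eq_iff:
  "zariski closure_of (\<Union>a\<in>A. D a) = zariski closure_of (\<Union>b\<in>B. D b)
    \<longleftrightarrow> perp A = perp (B :: 'a set)"
proof -
  \<comment> \<open>The closure determines \<open>perp A\<close>, because an annihilator is the
    intersection of the primes containing it.\<close>
  have "perp A = \<Inter>{P \<in> Spec. perp A \<subseteq> P}" for A :: "'a set"
  proof
    show "\<Inter>{P \<in> Spec. perp A \<subseteq> P} \<subseteq> perp A"
      unfolding perp_eq_Inter[of A] perp_eq_Inter_min_primes
      by (auto simp: Min_Spec_def)
  qed blast
  then show ?thesis unfolding closure_of_Union_D by metis
qed

lemma closure_interior_V_eq_iff:
  "zariski closure_of (zariski interior_of V x) = zariski closure_of D y
    \<longleftrightarrow> perp (perp {x}) = perp {y :: 'a}"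
  using closure_of_Union_D_eq_iff[of "perp {x}" "{y}"] by (simp add: interior_of_V)

section \<open>The equivalent conditions\<close>

lemma perp_eq_perp_perp_iff:
  "perp {x} = perp (perp {y}) \<longleftrightarrow> y \<in> perp {x :: 'a} \<and> perp {x} \<inter> perp {y} = {bot}"
proof
  assume "perp {x} = perp (perp {y})"
  then show "y \<in> perp {x} \<and> perp {x} \<inter> perp {y} = {bot}"
    using subset_perp_perp[of "{y}"] perp_inter_perp_perp[of "{y}"] by auto
next
  assume "y \<in> perp {x} \<and> perp {x} \<inter> perp {y} = {bot}"
  then show "perp {x} = perp (perp {y})"
    using perp_perp_eqI[of "{x}" y] perp_sym by auto
qed

text \<open>Applying \<open>perp\<close> to either of the equations in (2) and in the annihilator
  form of (4) gives the other, as three annihilators collapse to one.\<close>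

lemma perp_perp_eq_perp_iff:
  "perp (perp {x}) = perp {y :: 'a} \<longleftrightarrow> y \<in> perp {x} \<and> perp {x} \<inter> perp {y} = {bot}"
  unfolding perp_eq_perp_perp_iff[symmetric] by (metis perp_perp_perp)

lemma weakly_quasi_complementedI_compact:
  assumes comp: "compact_space (subtopology zariski (Min_Spec :: 'a set set))"
    and nontriv: "(UNIV :: 'a set) \<noteq> {bot}"
  shows "weakly_quasi_complemented TYPE('a)"
  unfolding weakly_quasi_complemented_def
proof
  fix x :: 'a
  \<comment> \<open>These sets cover \<open>Min_Spec\<close>: a minimal prime containing
    \<open>x\<close> misses some element of \<open>perp {x}\<close>. A finite subcover will supply
    the finitely many \<open>y\<close>.\<close>
  define \<U> where "\<U> = (\<lambda>a. Min_Spec \<inter> D a) ` insert x (perp {x})"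
  have "\<forall>U\<in>\<U>. openin (subtopology zariski Min_Spec) U"
    by (auto simp: \<U>_def openin_subtopology_Int2 openin_D)
  moreover have "topspace (subtopology zariski Min_Spec) \<subseteq> \<Union>\<U>"
  proof
    fix P assume "P \<in> topspace (subtopology zariski (Min_Spec :: 'a set set))"
    then have P: "P \<in> Min_Spec" "P \<in> Spec" by (auto simp: topspace_zariski)
    have "\<exists>a\<in>insert x (perp {x}). a \<notin> P" using min_prime_mem_iff[OF P(1)] by blast
    then show "P \<in> \<Union>\<U>" using P by (auto simp: \<U>_def D_def V_def)
  qed
  ultimately have "\<exists>\<F>. finite \<F> \<and> \<F> \<subseteq> \<U> \<and> topspace (subtopology zariski Min_Spec) \<subseteq> \<Union>\<F>"
    by (intro comp[unfolded compact_space_alt, rule_format] conjI)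
  then obtain \<F> where \<F>: "finite \<F>" "\<F> \<subseteq> \<U>"
    "topspace (subtopology zariski Min_Spec) \<subseteq> \<Union>\<F>"
    by blast
  obtain A where A: "A \<subseteq> insert x (perp {x})" "finite A" "\<F> = (\<lambda>a. Min_Spec \<inter> D a) ` A"
    using finite_subset_image[OF \<F>(1) \<F>(2)[unfolded \<U>_def]] by blast
  define Y where "Y = A - {x}"
  have Y: "finite Y" "Y \<subseteq> perp {x}" "x \<notin> Y" using A by (auto simp: Y_def)
  have "z = bot" if z: "z \<in> perp {x}" "z \<in> perp Y" for z
  proof (rule ccontr)
    assume "z \<noteq> bot"
    then obtain P where P: "P \<in> Min_Spec" "z \<notin> P" by (rule min_prime_separates)
    then have "P \<in> \<Union>\<F>" using \<F>(3) by (auto simp: topspace_zariski Min_Spec_def)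
    then obtain a where "a \<in> A" "a \<notin> P" unfolding A(3) D_def V_def by blast
    then have "z \<in> perp {a}" using z by (auto simp: Y_def perp_eq_Inter[of "A - {x}"])
    then show False using P \<open>a \<notin> P\<close> unfolding perp_eq_Inter_min_primes by blast
  qed
  then have "perp {x} \<inter> perp Y = {bot}" using bot_in_perp by blast
  note eq = perp_perp_eqI[OF Y(2) this, unfolded perp_eq_Inter[of Y]]
  show "\<exists>Y. finite Y \<and> Y \<noteq> {} \<and> x \<notin> Y \<and> perp (perp {x}) = (\<Inter>y\<in>Y. perp {y})"
  \<comment> \<open>The index set must be nonempty and avoid \<open>x\<close>. For
    \<open>x = bot\<close> an empty \<open>Y\<close> would make the intersection
    \<open>UNIV\<close>, whereas the double annihilator is \<open>{bot}\<close>; otherwise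
    \<open>bot\<close> may be added, since \<open>perp {bot} = UNIV\<close>.\<close>
  proof (cases "x = bot")
    case True
    have "perp (perp {x}) = {bot}"
      using perp_inter_perp_perp[of "{x}"] by (simp add: True perp_bot)
    then have "Y \<noteq> {}" using eq nontriv by auto
    then show ?thesis using eq Y by blast
  next
    case False
    then show ?thesis
      using eq Y by (intro exI[of _ "insert bot Y"]) (simp add: perp_bot)
  qed
qed

lemma annihilator_condition_finite:
  assumes ac: "annihilator_condition TYPE('a)" and "finite Y" "Y \<noteq> {}"
  shows "\<exists>z. (\<Inter>y\<in>Y. perp {y :: 'a}) = perp {z}"
  using assms(2,3)
proof (induction Y rule: finite_ne_induct)
  case (insert y Y)
  then obtain z where "(\<Inter>y\<in>Y. perp {y}) = perp {z}" by blast
  moreover obtain w where "perp {y} \<inter> perp {z} = perp {w}"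
    using ac unfolding annihilator_condition_def by blast
  ultimately show ?case by auto
qed auto

text \<open>The witness is the join of \<open>x\<close> and \<open>y\<close>: the ideal
  \<open>perp {w}\<close> contains it iff it contains both.\<close>

lemma lattice_imp_annihilator_condition:
  assumes "is_lattice TYPE('a)"
  shows "annihilator_condition TYPE('a)"
  unfolding annihilator_condition_def
proof (intro allI)
  fix x y :: 'a
  obtain s where s: "s \<in> ubs {x, y}" "\<And>u. u \<in> ubs {x, y} \<Longrightarrow> s \<le> u"
    using assms unfolding is_lattice_def by blast
  have "w \<in> perp {s} \<longleftrightarrow> w \<in> perp {x} \<and> w \<in> perp {y}" for w
  proof
    assume "w \<in> perp {s}"
    then have "s \<in> perp {w}" using perp_sym by blast
    moreover have "x \<le> s" "y \<le> s" using s(1) by (auto simp: ubs_def)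
    ultimately have "x \<in> perp {w}" "y \<in> perp {w}" by (auto intro: perp_downward)
    then show "w \<in> perp {x} \<and> w \<in> perp {y}" using perp_sym by blast
  next
    assume "w \<in> perp {x} \<and> w \<in> perp {y}"
    then have "x \<in> perp {w}" "y \<in> perp {w}" using perp_sym by blast+
    then have "lbs (ubs {x, y}) \<subseteq> perp {w}"
      using poset_ideal_perp[of "{w}"] by (simp add: poset_ideal_def)
    moreover have "s \<in> lbs (ubs {x, y})" using s by (auto simp: lbs_def)
    ultimately show "w \<in> perp {s}" using perp_sym by blast
  qed
  then show "\<exists>z. perp {x} \<inter> perp {y} = perp {z}" by blast
qed

lemma lattice_compact_Min_Spec:
  assumes lat: "is_lattice TYPE('a)"
    and compl: "\<forall>x::'a. \<exists>y. V_min y = V_min_set (perp {x})"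
  shows "compact_space (subtopology zariski (Min_Spec :: 'a set set))"
  unfolding compact_space_alt
proof (intro allI impI, elim conjE, rule ccontr)
  fix \<U> :: "'a set set set"
  assume op: "\<forall>U\<in>\<U>. openin (subtopology zariski Min_Spec) U"
    and cov: "topspace (subtopology zariski Min_Spec) \<subseteq> \<Union>\<U>"
    and no: "\<not> (\<exists>\<F>. finite \<F> \<and> \<F> \<subseteq> \<U> \<and> topspace (subtopology zariski Min_Spec) \<subseteq> \<Union>\<F>)"
  have top: "topspace (subtopology zariski Min_Spec) = (Min_Spec :: 'a set set)"
    by (auto simp: topspace_zariski Min_Spec_def)
  \<comment> \<open>\<open>I\<close> collects the elements whose basic open set in
    \<open>Min_Spec\<close> is finitely covered; \<open>F\<close> collects those sharing no minimal
    prime with some member of \<open>I\<close>.\<close>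
  define I where "I = {a :: 'a. \<exists>\<F>. finite \<F> \<and> \<F> \<subseteq> \<U> \<and> Min_Spec - V_min a \<subseteq> \<Union>\<F>}"
  define F where "F = {y :: 'a. \<exists>a\<in>I. \<forall>P\<in>Min_Spec. a \<in> P \<longrightarrow> y \<notin> P}"
  have ideal: "poset_ideal P" if "P \<in> Min_Spec" for P :: "'a set"
    using Min_Spec_prime[OF that] by (simp add: prime_ideal_def)
  have bot_I: "bot \<in> I"
    unfolding I_def using ideal poset_ideal_bot
    by (auto simp: V_min_def V_def Min_Spec_def intro!: exI[of _ "{}"])
  have compl': "\<exists>y. \<forall>P\<in>Min_Spec. y \<in> P \<longleftrightarrow> x \<notin> P" for x :: 'a
  proof -
    obtain y where "V_min y = V_min_set (perp {x})" using compl by blast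
    then have "\<forall>P\<in>Min_Spec. y \<in> P \<longleftrightarrow> x \<notin> P"
      unfolding V_min_set_perp by (auto simp: V_min_def V_def Min_Spec_def)
    then show ?thesis by blast
  qed
  \<comment> \<open>The complement of \<open>a\<close> supplied by (5) belongs to \<open>F\<close>.
    A minimal prime disjoint from \<open>F\<close> therefore contains all of
    \<open>I\<close>.\<close>
  have mem_F: "\<exists>y\<in>F. \<forall>P\<in>Min_Spec. y \<in> P \<longleftrightarrow> a \<notin> P" if "a \<in> I" for a
    using compl'[of a] that unfolding F_def by blast
  have "\<exists>c\<in>F. c \<le> y \<and> c \<le> y'" if yy: "y \<in> F" "y' \<in> F" for y y'
  proof -
    obtain a a' where a: "a \<in> I" "\<forall>P\<in>Min_Spec. a \<in> P \<longrightarrow> y \<notin> P"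
      and a': "a' \<in> I" "\<forall>P\<in>Min_Spec. a' \<in> P \<longrightarrow> y' \<notin> P"
      using yy unfolding F_def by blast
    obtain s where s: "s \<in> ubs {a, a'}" "\<And>u. u \<in> ubs {a, a'} \<Longrightarrow> s \<le> u"
      using lat unfolding is_lattice_def by blast
    obtain i where i: "i \<in> lbs {y, y'}" "\<And>l. l \<in> lbs {y, y'} \<Longrightarrow> l \<le> i"
      using lat unfolding is_lattice_def by blast
    \<comment> \<open>Joins of witnesses stay in \<open>I\<close>, since their basic open sets
      unite; the meet of \<open>y\<close> and \<open>y'\<close> avoids every minimal prime
      containing \<open>s\<close>.\<close>
    have s_mem: "s \<in> P \<longleftrightarrow> a \<in> P \<and> a' \<in> P" if P: "P \<in> Min_Spec" for P
    proof
      show "s \<in> P \<Longrightarrow> a \<in> P \<and> a' \<in> P"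
        using s(1) poset_ideal_downward[OF ideal[OF P]] by (auto simp: ubs_def)
      have "s \<in> lbs (ubs {a, a'})" using s by (auto simp: lbs_def)
      then show "a \<in> P \<and> a' \<in> P \<Longrightarrow> s \<in> P"
        using ideal[OF P] unfolding poset_ideal_def by blast
    qed
    obtain \<F> \<F>' where \<F>: "finite \<F>" "\<F> \<subseteq> \<U>" "Min_Spec - V_min a \<subseteq> \<Union>\<F>"
      "finite \<F>'" "\<F>' \<subseteq> \<U>" "Min_Spec - V_min a' \<subseteq> \<Union>\<F>'"
      using a(1) a'(1) unfolding I_def by blast
    have "Min_Spec - V_min s \<subseteq> (Min_Spec - V_min a) \<union> (Min_Spec - V_min a')"
      using s_mem by (auto simp: V_min_def V_def Min_Spec_def)
    then have "Min_Spec - V_min s \<subseteq> \<Union>(\<F> \<union> \<F>')" using \<F> by blast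
    then have "s \<in> I" using \<F> unfolding I_def by (intro CollectI exI[of _ "\<F> \<union> \<F>'"]) simp
    moreover have "i \<notin> P" if P: "P \<in> Min_Spec" "s \<in> P" for P
    proof
      assume "i \<in> P"
      then have "lbs {y, y'} \<subseteq> P"
        using i(2) poset_ideal_downward[OF ideal[OF P(1)]] by blast
      then have "y \<in> P \<or> y' \<in> P"
        using Min_Spec_prime[OF P(1)] unfolding prime_ideal_def by blast
      then show False using a(2) a'(2) P s_mem by blast
    qed
    ultimately have "i \<in> F" unfolding F_def by blast
    then show ?thesis using i(1) by (auto simp: lbs_def)
  qed
  moreover have "z \<in> F" if yz: "y \<in> F" "y \<le> z" for y z
  proof -
    obtain a where "a \<in> I" "\<And>P. P \<in> Min_Spec \<Longrightarrow> a \<in> P \<Longrightarrow> y \<notin> P"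
      using yz(1) unfolding F_def by blast
    moreover have "y \<in> P" if "P \<in> Min_Spec" "z \<in> P" for P
      using poset_ideal_downward[OF ideal[OF that(1)] that(2) yz(2)] .
    ultimately show ?thesis unfolding F_def by blast
  qed
  moreover have "F \<noteq> {}" using mem_F[OF bot_I] by blast
  ultimately have "l_filter F" by (simp add: l_filter_iff)
  moreover have "bot \<notin> F"
  proof
    assume "bot \<in> F"
    \<comment> \<open>Such an \<open>a\<close> lies in no minimal prime, so its finite subcover
      would cover all of \<open>Min_Spec\<close>.\<close>
    then obtain a where a: "a \<in> I" "\<And>P. P \<in> Min_Spec \<Longrightarrow> a \<notin> P"
      using ideal poset_ideal_bot unfolding F_def by blast
    then have "V_min a = {}" by (auto simp: V_min_def V_def)
    then show False using a(1) no unfolding I_def top by auto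
  qed
  ultimately obtain P where P: "P \<in> Min_Spec" "P \<inter> F = {}"
    using l_filter_avoided_by_min_prime by blast
  have IP: "I \<subseteq> P" using P mem_F by blast
  obtain U where U: "U \<in> \<U>" "P \<in> U" using cov P(1) unfolding top by blast
  then obtain T where T: "openin zariski T" "U = T \<inter> Min_Spec"
    using op by (auto simp: openin_subtopology)
  have "P \<in> T" using U T by blast
  then obtain a where a: "P \<in> D a" "D a \<subseteq> T" using openin_zariski_base[OF T(1)] by blast
  \<comment> \<open>The single set \<open>U\<close> covers the neighbourhood of \<open>P\<close>
    given by \<open>a\<close>. Hence \<open>a\<close> is in \<open>I\<close> and so in
    \<open>P\<close>, a contradiction.\<close>
  have "Min_Spec - V_min a \<subseteq> \<Union>{U}"
    using a T by (auto simp: D_def V_min_def Min_Spec_def)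
  then have "a \<in> I" using U(1) unfolding I_def by blast
  then show False using IP a(1) by (auto simp: D_def V_def)
qed

end

section \<open>The zero-divisor graph\<close>

lemma mem_zd_verts_iff: "x \<in> zd_verts \<longleftrightarrow> x \<noteq> bot \<and> (\<exists>y\<in>perp {x}. y \<noteq> bot)"
  by (auto simp: zd_verts_def lbs_eq_bot_iff_perp)

lemma zd_adj_iff: "zd_adj x y \<longleftrightarrow> x \<noteq> bot \<and> y \<noteq> bot \<and> y \<in> perp {x}"
  unfolding zd_adj_def lbs_eq_bot_iff_perp mem_zd_verts_iff
  using perp_sym self_in_perp_iff by blast

text \<open>A common neighbour of \<open>a\<close> and \<open>b\<close> is exactly a nonzero element
  annihilating both, so (6) is (3) restricted to vertices.\<close>

lemma graph_orth_zd_iff: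
  "graph_orth zd_verts zd_adj a b \<longleftrightarrow>
    a \<noteq> bot \<and> b \<noteq> bot \<and> b \<in> perp {a} \<and> perp {a} \<inter> perp {b} = {bot}"
  (is "?L \<longleftrightarrow> ?R")
proof
  assume L: ?L
  then have ab: "a \<noteq> bot" "b \<noteq> bot" "b \<in> perp {a}"
    by (auto simp: graph_orth_def zd_adj_iff)
  have "c = bot" if "c \<in> perp {a}" "c \<in> perp {b}" for c
  proof (rule ccontr)
    assume "c \<noteq> bot"
    then have "zd_adj c a" "zd_adj c b" using ab that perp_sym zd_adj_iff by blast+
    then show False using L unfolding graph_orth_def zd_adj_def by blast
  qed
  then show ?R using ab bot_in_perp by blast
next
  assume R: ?R
  then have "zd_adj a b" by (simp add: zd_adj_iff)
  moreover have "\<not> (zd_adj c a \<and> zd_adj c b)" for c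
    using R perp_sym unfolding zd_adj_iff by blast
  ultimately show ?L by (auto simp: graph_orth_def zd_adj_def)
qed

lemma zd_graph_complemented_iff_uniquely:
  "complemented_graph (zd_verts :: 'a::order_bot set) zd_adj \<longleftrightarrow>
   uniquely_complemented_graph (zd_verts :: 'a set) zd_adj"
proof -
  have adj: "zd_adj d c"
    if o: "graph_orth zd_verts zd_adj a b" "graph_orth zd_verts zd_adj a c"
    and db: "zd_adj d b" for a b c d :: 'a
  proof -
    \<comment> \<open>Any orthogonal partner of \<open>a\<close> has annihilator
      \<open>perp (perp {a})\<close>, and the neighbours of a vertex are the nonzero elements of its
      annihilator.\<close>
    have "perp {b} = perp (perp {a})" "perp {c} = perp (perp {a})"
      using o perp_perp_eqI[of "{b}" a] perp_perp_eqI[of "{c}" a] by (auto simp: graph_orth_zd_iff)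
    then have "perp {b} = perp {c}" by simp
    moreover have "d \<noteq> bot" "d \<in> perp {b}" using db perp_sym[of b d] by (auto simp: zd_adj_iff)
    moreover have "c \<noteq> bot" using o(2) by (simp add: graph_orth_zd_iff)
    ultimately show ?thesis using perp_sym[of d c] by (simp add: zd_adj_iff)
  qed
  then show ?thesis unfolding uniquely_complemented_graph_def by blast
qed

lemma zd_graph_complementedI:
  assumes "\<forall>x::'a::order_bot. \<exists>y\<in>perp {x}. perp {x} \<inter> perp {y} = {bot}"
  shows "complemented_graph (zd_verts :: 'a set) zd_adj"
  unfolding complemented_graph_def
proof
  fix a :: 'a assume a: "a \<in> zd_verts"
  obtain b where b: "b \<in> perp {a}" "perp {a} \<inter> perp {b} = {bot}" using assms by blast
  \<comment> \<open>With \<open>b = bot\<close> the intersection would be \<open>perp {a}\<close>,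
    which is nonzero at a vertex.\<close>
  have "b \<noteq> bot" using a b(2) perp_bot unfolding mem_zd_verts_iff by blast
  then have "graph_orth zd_verts zd_adj a b"
    using a b by (simp add: graph_orth_zd_iff mem_zd_verts_iff)
  then show "\<exists>b\<in>zd_verts. graph_orth zd_verts zd_adj a b" unfolding graph_orth_def by blast
qed

lemma zd_graph_complementedD:
  assumes gr: "complemented_graph (zd_verts :: 'a::order_bot set) zd_adj"
    and ac: "annihilator_condition TYPE('a)" and nontriv: "(UNIV :: 'a set) \<noteq> {bot}"
  shows "\<exists>y\<in>perp {x :: 'a}. perp {x} \<inter> perp {y} = {bot}"
proof -
  have nonzero: "\<exists>y\<in>perp {x}. perp {x} \<inter> perp {y} = {bot}" if "x \<noteq> bot" for x :: 'a
  proof (cases "x \<in> zd_verts")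
    case True
    then show ?thesis using gr unfolding complemented_graph_def graph_orth_zd_iff by blast
  next
    case False
    \<comment> \<open>A nonzero non-vertex is dense, so \<open>bot\<close> serves as its
      complement.\<close>
    then have "perp {x} = {bot}" using that bot_in_perp unfolding mem_zd_verts_iff by blast
    then show ?thesis by (simp add: perp_bot)
  qed
  show ?thesis
  proof (cases "x = bot")
    case True
    \<comment> \<open>For \<open>x = bot\<close>, (3) asks for a dense element. The annihilator
      condition, applied to a nonzero \<open>a\<close> and its complement, produces one.\<close>
    obtain a :: 'a where "a \<noteq> bot" using nontriv by auto
    then obtain b where "perp {a} \<inter> perp {b} = {bot}" using nonzero by blast
    then obtain z where "perp {z} = {bot :: 'a}"
      using ac unfolding annihilator_condition_def by metis
    then show ?thesis by (auto simp: True perp_bot)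
  qed (use nonzero in blast)
qed

theorem mainTheorem1:
  assumes "P_l_MFP TYPE('a::order_bot)"
    and "(UNIV :: 'a set) \<noteq> {bot}"
  shows
    "let S1 = quasi_complemented TYPE('a);
         S2 = (\<forall>x::'a. \<exists>y. perp {x} = perp (perp {y}));
         S3 = (\<forall>x::'a. \<exists>y\<in>perp {x}. perp {x} \<inter> perp {y} = {bot});
         S4 = (\<forall>x::'a. \<exists>y. zariski closure_of (zariski interior_of V x) = zariski closure_of D y);
         S5 = (\<forall>x::'a. \<exists>y. V_min y = V_min_set (perp {x}));
         S6 = complemented_graph (zd_verts :: 'a set) zd_adj;
         S7 = uniquely_complemented_graph (zd_verts :: 'a set) zd_adj;
         S8 = weakly_quasi_complemented TYPE('a);
         S9 = compact_space (subtopology zariski (Min_Spec :: 'a set set))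
     in (S1 \<longleftrightarrow> S2) \<and> (S2 \<longleftrightarrow> S3) \<and> (S3 \<longleftrightarrow> S4) \<and> (S4 \<longleftrightarrow> S5) \<and>
        (S3 \<longrightarrow> S6) \<and> (S6 \<longleftrightarrow> S7) \<and> (S1 \<longrightarrow> S8) \<and> (S9 \<longrightarrow> S8) \<and>
        (Min_Spec :: 'a set set) = Min_s \<and>
        (annihilator_condition TYPE('a) \<longrightarrow>
           (S1 \<longleftrightarrow> S2) \<and> (S2 \<longleftrightarrow> S3) \<and> (S3 \<longleftrightarrow> S4) \<and> (S4 \<longleftrightarrow> S5) \<and>
           (S5 \<longleftrightarrow> S6) \<and> (S6 \<longleftrightarrow> S7) \<and> (S7 \<longleftrightarrow> S8)) \<and>
        (is_lattice TYPE('a) \<longrightarrow>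
           (S1 \<longleftrightarrow> S2) \<and> (S2 \<longleftrightarrow> S3) \<and> (S3 \<longleftrightarrow> S4) \<and> (S4 \<longleftrightarrow> S5) \<and>
           (S5 \<longleftrightarrow> S6) \<and> (S6 \<longleftrightarrow> S7) \<and> (S7 \<longleftrightarrow> S8) \<and> (S8 \<longleftrightarrow> S9))"
proof -
  note mfp = assms(1)
  define S3 where "S3 \<longleftrightarrow> (\<forall>x::'a. \<exists>y\<in>perp {x}. perp {x} \<inter> perp {y} = {bot})"
  define S6 where "S6 \<longleftrightarrow> complemented_graph (zd_verts :: 'a set) zd_adj"
  define S8 where "S8 \<longleftrightarrow> weakly_quasi_complemented TYPE('a)"
  define S9 where "S9 \<longleftrightarrow> compact_space (subtopology zariski (Min_Spec :: 'a set set))"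
  \<comment> \<open>(1) and (8) require witnesses distinct from \<open>x\<close>. This is automatic
    as \<open>Q\<close> is nontrivial: \<open>y = x\<close> forces \<open>x = bot\<close>, whose
    annihilator is everything.\<close>
  have ne: "y \<noteq> x" if "y \<in> perp {x}" "perp {x} \<inter> perp {y} = {bot}" for x y :: 'a
  proof
    assume "y = x"
    with that(1) have "x = bot" by (simp add: self_in_perp_iff)
    then show False using that(2) assms(2) \<open>y = x\<close> by (simp add: perp_bot)
  qed
  have 1: "quasi_complemented TYPE('a) \<longleftrightarrow> S3"
    unfolding quasi_complemented_def S3_def lbs_eq_bot_iff_perp perp_ideal_join[OF mfp]
    using ne by blast
  have 2: "(\<forall>x::'a. \<exists>y. perp {x} = perp (perp {y})) \<longleftrightarrow> S3"
    unfolding perp_eq_perp_perp_iff[OF mfp] S3_def by blast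
  have 4: "(\<forall>x::'a. \<exists>y. zariski closure_of (zariski interior_of V x) = zariski closure_of D y) \<longleftrightarrow> S3"
    unfolding closure_interior_V_eq_iff[OF mfp] perp_perp_eq_perp_iff[OF mfp] S3_def by blast
  have 5: "(\<forall>x::'a. \<exists>y. V_min y = V_min_set (perp {x})) \<longleftrightarrow> S3"
    unfolding V_min_eq_V_min_set_perp_iff[OF mfp] S3_def by blast
  have 36: "S3 \<longrightarrow> S6" unfolding S3_def S6_def using zd_graph_complementedI by blast
  have 67: "uniquely_complemented_graph (zd_verts :: 'a set) zd_adj \<longleftrightarrow> S6"
    unfolding S6_def using zd_graph_complemented_iff_uniquely by blast
  have 38: "S3 \<longrightarrow> S8"
  proof
    assume S3
    have "\<exists>Y. finite Y \<and> Y \<noteq> {} \<and> x \<notin> Y \<and> perp (perp {x}) = (\<Inter>y\<in>Y. perp {y})" for x :: 'a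
    proof -
      obtain y where y: "y \<in> perp {x}" "perp {x} \<inter> perp {y} = {bot}"
        using \<open>S3\<close> unfolding S3_def by blast
      then have "perp (perp {x}) = perp {y}" using perp_perp_eq_perp_iff[OF mfp] by blast
      then show ?thesis using ne[OF y] by (intro exI[of _ "{y}"]) auto
    qed
    then show S8 unfolding S8_def weakly_quasi_complemented_def by blast
  qed
  have 98: "S9 \<longrightarrow> S8"
    unfolding S8_def S9_def using weakly_quasi_complementedI_compact[OF mfp _ assms(2)] by blast
  have 63: "S6 \<longrightarrow> S3" if "annihilator_condition TYPE('a)"
    unfolding S3_def S6_def using zd_graph_complementedD[OF _ that assms(2)] by blast
  \<comment> \<open>The annihilator condition collapses the finite intersection in (8) to one
    annihilator, which gives the annihilator form of (4).\<close>
  have 83: "S8 \<longrightarrow> S3" if ac: "annihilator_condition TYPE('a)"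
  proof
    assume S8
    have "\<exists>z. perp (perp {x}) = perp {z}" for x :: 'a
    proof -
      obtain Y where Y: "finite Y" "Y \<noteq> {}" "perp (perp {x}) = (\<Inter>y\<in>Y. perp {y})"
        using \<open>S8\<close> unfolding S8_def weakly_quasi_complemented_def by blast
      then show ?thesis using annihilator_condition_finite[OF mfp ac Y(1,2)] by simp
    qed
    then show S3 unfolding perp_perp_eq_perp_iff[OF mfp] S3_def by blast
  qed
  have 39: "S3 \<longrightarrow> S9" if "is_lattice TYPE('a)"
    unfolding S9_def 5[symmetric] using lattice_compact_Min_Spec[OF mfp that] by blast
  have lat: "is_lattice TYPE('a) \<longrightarrow> annihilator_condition TYPE('a)"
    using lattice_imp_annihilator_condition[OF mfp] by blast
  show ?thesis
    unfolding Let_def 1 2 4 5 67 S3_def[symmetric] S6_def[symmetric] S8_def[symmetric]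
      S9_def[symmetric]
    using 36 38 98 63 83 39 lat Min_Spec_eq_Min_s[OF mfp] by blast
qed

end
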